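(* A permutation $w\in S_n$ is dominant if and only if its Schubert polynomial $\mathfrak{S}_w$ is a monomial; that is, $w$ is dominant if and only if the single Schubert polynomial $\mathfrak{S}_w(x)$ is a monomial in the variables $x_i$, and likewise if and only if the double Schubert polynomial $\mathfrak{S}_w(x;y)$ is a product of binomials of the form $x_i-y_j$.
   Context: Dominant permutations: for a partition $\lambda$ with $n\ge\lambda_i+i$ for all $i$ with $\lambda_i>0$, $w(\lambda)\in S_n$ is defined by $w(1)=\lambda_1+1$ and $w(i)=$ the $(\lambda_i+1)$st smallest element of $\{1,\ldots,n\}\setminus\{w(1),\ldots,w(i-1)\}$. The permutations of the form $w(\lambda)$ are called dominant. Schubert polynomials: $\ell(w)$ is the number of inversions, $s_i=(i\ i{+}1)$, $w_0=[n,n-1,\ldots,1]$, $\partial_iP(x;y)=\frac{P(x;y)-P(\ldots,x_{i+1},x_i,\ldots;y)}{x_i-x_{i+1}}$. Double Schubert polynomials are determined by $\mathfrak{S}_{w_0}(x;y)=\prod_{i+j\le n}(x_i-y_j)$ and $\partial_i\mathfrak{S}_w=\mathfrak{S}_{ws_i}$ if $\ell(ws_i)<\ell(w)$, and $0$ otherwise. Single Schubert polynomials are $\mathfrak{S}_w(x)=\mathfrak{S}_w(x;0)$. *)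

theory Defs
  imports "HOL-Library.Poly_Mapping" "HOL-Library.Multiset" "HOL-Combinatorics.Permutations"
begin

section \<open>Permutations\<close>

text \<open>An element of \<open>S\<^sub>n\<close> is a function \<open>w :: nat \<Rightarrow> nat\<close> with \<open>w permutes {1..n}\<close>. Products in \<open>S\<^sub>n\<close>
  are composed from right to left, so \<open>w s\<^sub>i = w \<circ> s\<^sub>i\<close> exchanges the values of \<open>w\<close> at the
  positions \<open>i\<close> and \<open>i + 1\<close>.\<close>

definition perm_length :: "nat \<Rightarrow> (nat \<Rightarrow> nat) \<Rightarrow> nat" where
  "perm_length n w = card {(i, j). 1 \<le> i \<and> i < j \<and> j \<le> n \<and> w i > w j}"

abbreviation simple_transposition :: "nat \<Rightarrow> nat \<Rightarrow> nat" where
  "simple_transposition i \<equiv> Transposition.transpose i (Suc i)"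

definition longest_perm :: "nat \<Rightarrow> nat \<Rightarrow> nat" where
  "longest_perm n i = (if i \<in> {1..n} then n + 1 - i else i)"

text \<open>A partition is given by its parts \<open>\<lambda>\<^sub>1 \<ge> \<lambda>\<^sub>2 \<ge> \<dots>\<close>, with infinitely many trailing zeros; the
  value at index 0 is irrelevant.\<close>

definition is_partition :: "(nat \<Rightarrow> nat) \<Rightarrow> bool" where
  "is_partition lam \<longleftrightarrow> (\<forall>i\<ge>1. lam (Suc i) \<le> lam i) \<and> finite {i. 1 \<le> i \<and> lam i > 0}"

text \<open>List indices start at 0, so \<open>sorted_list_of_set A ! k\<close> is the \<open>(k + 1)\<close>st smallest element
  of the finite set \<open>A\<close>.\<close>

fun dominant_perm :: "nat \<Rightarrow> (nat \<Rightarrow> nat) \<Rightarrow> nat \<Rightarrow> nat" where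
  "dominant_perm n lam i =
     (if i \<in> {1..n}
      then sorted_list_of_set ({1..n} - (\<lambda>j. dominant_perm n lam j) ` {1..<i}) ! lam i
      else i)"

declare dominant_perm.simps [simp del]

definition dominant :: "nat \<Rightarrow> (nat \<Rightarrow> nat) \<Rightarrow> bool" where
  "dominant n w \<longleftrightarrow>
     (\<exists>lam. is_partition lam \<and> (\<forall>i\<ge>1. lam i > 0 \<longrightarrow> lam i + i \<le> n) \<and> w = dominant_perm n lam)"


section \<open>Polynomials in the variables \<open>x\<^sub>i\<close> and \<open>y\<^sub>j\<close>\<close>

datatype var = X nat | Y nat

text \<open>The linear order on variables only serves to make the polynomial ring an instance of
  \<^class>\<open>idom\<close>.\<close>

instantiation var :: linorder
begin

fun less_eq_var :: "var \<Rightarrow> var \<Rightarrow> bool" where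
  "less_eq_var (X i) (X j) \<longleftrightarrow> i \<le> j"
| "less_eq_var (X i) (Y j) \<longleftrightarrow> True"
| "less_eq_var (Y i) (X j) \<longleftrightarrow> False"
| "less_eq_var (Y i) (Y j) \<longleftrightarrow> i \<le> j"

definition less_var :: "var \<Rightarrow> var \<Rightarrow> bool" where
  "less_var u v \<longleftrightarrow> u \<le> v \<and> \<not> v \<le> u"

instance
proof
  fix u v w :: var
  show "u < v \<longleftrightarrow> u \<le> v \<and> \<not> v \<le> u" by (rule less_var_def)
  show "u \<le> u" by (cases u) auto
  show "u \<le> v \<Longrightarrow> v \<le> w \<Longrightarrow> u \<le> w" by (cases u; cases v; cases w) auto
  show "u \<le> v \<Longrightarrow> v \<le> u \<Longrightarrow> u = v" by (cases u; cases v) auto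
  show "u \<le> v \<or> v \<le> u" by (cases u; cases v) auto
qed

end

text \<open>Polynomials over the integers: finitely supported functions from exponent vectors to
  coefficients.\<close>

type_synonym poly_xy = "(var \<Rightarrow>\<^sub>0 nat) \<Rightarrow>\<^sub>0 int"

definition Var :: "var \<Rightarrow> poly_xy" where
  "Var v = Poly_Mapping.single (Poly_Mapping.single v 1) 1"

abbreviation xvar :: "nat \<Rightarrow> poly_xy" where "xvar i \<equiv> Var (X i)"
abbreviation yvar :: "nat \<Rightarrow> poly_xy" where "yvar j \<equiv> Var (Y j)"

definition substitute :: "(var \<Rightarrow> poly_xy) \<Rightarrow> poly_xy \<Rightarrow> poly_xy" where
  "substitute \<sigma> P =
     (\<Sum>m\<in>Poly_Mapping.keys P. of_int (Poly_Mapping.lookup P m) *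
        (\<Prod>v\<in>Poly_Mapping.keys m. \<sigma> v ^ Poly_Mapping.lookup m v))"

definition swap_x :: "nat \<Rightarrow> poly_xy \<Rightarrow> poly_xy" where
  "swap_x i = substitute (case_var (\<lambda>k. xvar (simple_transposition i k)) yvar)"

definition set_y_zero :: "poly_xy \<Rightarrow> poly_xy" where
  "set_y_zero = substitute (case_var xvar (\<lambda>j. 0))"

text \<open>The quotient of \<open>P - swap_x i P\<close> by \<open>x\<^sub>i - x\<^sub>i\<^sub>+\<^sub>1\<close> in the polynomial ring.\<close>

definition divided_difference :: "nat \<Rightarrow> poly_xy \<Rightarrow> poly_xy" where
  "divided_difference i P = (THE Q. (xvar i - xvar (Suc i)) * Q = P - swap_x i P)"

lemma divided_difference_eqI:
  assumes "(xvar i - xvar (Suc i)) * Q = P - swap_x i P"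
  shows "divided_difference i P = Q"
proof -
  have "xvar i \<noteq> xvar (Suc i)"
    unfolding Var_def by (metis inj_single injD lookup_single_eq lookup_single_not_eq n_not_Suc_n
        var.inject(1) zero_neq_one)
  then show ?thesis
    unfolding divided_difference_def using assms
    by (intro the_equality) (auto simp flip: assms)
qed

section \<open>Schubert polynomials\<close>

definition schubert_family :: "nat \<Rightarrow> ((nat \<Rightarrow> nat) \<Rightarrow> poly_xy) \<Rightarrow> bool" where
  "schubert_family n S \<longleftrightarrow>
     S (longest_perm n) = (\<Prod>(i, j) \<in> {(i, j). 1 \<le> i \<and> 1 \<le> j \<and> i + j \<le> n}. xvar i - yvar j) \<and>
     (\<forall>w i. w permutes {1..n} \<and> 1 \<le> i \<and> i < n \<longrightarrow>
        divided_difference i (S w) =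
          (if perm_length n (w \<circ> simple_transposition i) < perm_length n w
           then S (w \<circ> simple_transposition i) else 0))"

text \<open>The conditions determine the values on \<open>S\<^sub>n\<close>; the values at other functions are irrelevant.\<close>

definition double_schubert :: "nat \<Rightarrow> (nat \<Rightarrow> nat) \<Rightarrow> poly_xy" where
  "double_schubert n = (SOME S. schubert_family n S)"

definition single_schubert :: "nat \<Rightarrow> (nat \<Rightarrow> nat) \<Rightarrow> poly_xy" where
  "single_schubert n w = set_y_zero (double_schubert n w)"

definition is_monomial :: "nat \<Rightarrow> poly_xy \<Rightarrow> bool" where
  "is_monomial n P \<longleftrightarrow> (\<exists>a :: nat \<Rightarrow> nat. P = (\<Prod>i\<in>{1..n}. xvar i ^ a i))"

text \<open>The multiset lists the index pairs of the factors, with repetitions allowed.\<close>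

definition is_binomial_product :: "nat \<Rightarrow> poly_xy \<Rightarrow> bool" where
  "is_binomial_product n P \<longleftrightarrow>
     (\<exists>M :: (nat \<times> nat) multiset. set_mset M \<subseteq> {1..n} \<times> {1..n} \<and>
        P = (\<Prod>(i, j) \<in># M. xvar i - yvar j))"

end

theory Submission
  imports Defs
begin

text \<open>Write \<open>c(w)\<close> for the Lehmer code, where \<open>c\<^sub>i(w)\<close> counts the positions after \<open>i\<close> with a smaller
  value. The recursive construction of \<open>w(\<lambda>)\<close> says that \<open>\<lambda>\<close> is the code of \<open>w(\<lambda>)\<close>, so the dominant
  permutations are those whose code is weakly decreasing (\<open>dominant_iff_code_decreasing\<close>).

  The double Schubert polynomials have to be shown to exist. Divided differences satisfy the
  commutation and braid relations, and a diamond argument along the ascents of a permutation shows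
  that the polynomial reached from the longest permutation does not depend on the route
  (\<open>schubert_ascent\<close>). From then on two facts are used: if \<open>w(i) < w(i+1)\<close>, then \<open>\<SS>\<^sub>w\<close> is the divided
  difference of \<open>\<SS>\<close> at \<open>w s\<^sub>i\<close>, and it is symmetric in \<open>x\<^sub>i\<close> and \<open>x\<^sub>i\<^sub>+\<^sub>1\<close>. Both directions proceed by
  downward induction from the longest permutation, with different choices of the ascent.

  If \<open>w\<close> is dominant, then \<open>\<SS>\<^sub>w(x;y)\<close> is the product of \<open>x\<^sub>a - y\<^sub>b\<close> over the cells \<open>(a, b)\<close> of the
  diagram with rows \<open>c(w)\<close> (\<open>double_schubert_dominant\<close>): the first ascent \<open>i\<close> joins two rows of
  equal length, and passing to \<open>w s\<^sub>i\<close> adds a cell to the upper one.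

  Conversely, the monomial with exponents \<open>c(w)\<close> has coefficient 1 in every \<open>\<SS>\<^sub>w\<close>
  (\<open>double_schubert_code_coeff\<close>); here the last ascent is used, since the values after it decrease and
  the exponent in question is the largest that the staircase bound admits. So if \<open>\<SS>\<^sub>w(x)\<close> is a
  monomial, it is this one. At an ascent \<open>i\<close> it is symmetric, which forces \<open>c\<^sub>i(w) = c\<^sub>i\<^sub>+\<^sub>1(w)\<close>; at a
  descent \<open>c\<^sub>i(w) > c\<^sub>i\<^sub>+\<^sub>1(w)\<close> anyway, and the code is decreasing. A binomial product becomes a
  monomial at \<open>y = 0\<close>, so this case is covered as well.\<close>

section \<open>Monomials and substitution homomorphisms\<close>

abbreviation monom :: "(var \<Rightarrow>\<^sub>0 nat) \<Rightarrow> int \<Rightarrow> poly_xy" where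
  "monom \<equiv> Poly_Mapping.single"

abbreviation coeff :: "poly_xy \<Rightarrow> (var \<Rightarrow>\<^sub>0 nat) \<Rightarrow> int" where
  "coeff \<equiv> Poly_Mapping.lookup"

abbreviation expo :: "(var \<Rightarrow>\<^sub>0 nat) \<Rightarrow> var \<Rightarrow> nat" where
  "expo \<equiv> Poly_Mapping.lookup"

lemma poly_eq_sum_monom: "P = (\<Sum>m\<in>Poly_Mapping.keys P. monom m (coeff P m))"
  by (rule poly_mapping_eqI)
    (auto simp: lookup_sum lookup_single when_def in_keys_iff)

text \<open>Monomials with coefficients span the polynomials, so identities between additive maps need
  checking on them only. This reduces multiplicativity of substitutions, and the formulas below
  for coefficients, to single monomials.\<close>

lemma additive_eqI:
  fixes f g :: "poly_xy \<Rightarrow> 'b::comm_monoid_add"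
  assumes "f 0 = g 0"
    and "\<And>P Q. f (P + Q) = f P + f Q" "\<And>P Q. g (P + Q) = g P + g Q"
    and "\<And>m c. f (monom m c) = g (monom m c)"
  shows "f P = g P"
proof -
  have "f (\<Sum>m\<in>A. monom m (coeff P m)) = g (\<Sum>m\<in>A. monom m (coeff P m))" if "finite A" for A
    using that by (induction A rule: finite_induct) (simp_all add: assms)
  then show ?thesis
    using poly_eq_sum_monom[of P] by (metis finite_keys)
qed

definition subst_monom :: "(var \<Rightarrow> poly_xy) \<Rightarrow> (var \<Rightarrow>\<^sub>0 nat) \<Rightarrow> poly_xy" where
  "subst_monom \<sigma> m = (\<Prod>v\<in>Poly_Mapping.keys m. \<sigma> v ^ expo m v)"

lemma subst_monom_superset:
  assumes "finite A" "Poly_Mapping.keys m \<subseteq> A"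
  shows "subst_monom \<sigma> m = (\<Prod>v\<in>A. \<sigma> v ^ expo m v)"
  unfolding subst_monom_def using assms
  by (intro prod.mono_neutral_left) (auto simp: in_keys_iff)

lemma subst_monom_add: "subst_monom \<sigma> (m + m') = subst_monom \<sigma> m * subst_monom \<sigma> m'"
proof -
  let ?A = "Poly_Mapping.keys m \<union> Poly_Mapping.keys m'"
  have "subst_monom \<sigma> k = (\<Prod>v\<in>?A. \<sigma> v ^ expo k v)"
    if "k \<in> {m, m', m + m'}" for k
    by (rule subst_monom_superset) (use that keys_add[of m m'] in auto)
  then show ?thesis
    by (simp add: lookup_add power_add prod.distrib)
qed

lemma subst_monom_zero [simp]: "subst_monom \<sigma> 0 = 1"
  by (simp add: subst_monom_def)

lemma subst_monom_single [simp]: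
  "subst_monom \<sigma> (Poly_Mapping.single v k) = \<sigma> v ^ k"
  by (simp add: subst_monom_def)

lemma substitute_superset:
  assumes "finite A" "Poly_Mapping.keys P \<subseteq> A"
  shows "substitute \<sigma> P = (\<Sum>m\<in>A. of_int (coeff P m) * subst_monom \<sigma> m)"
  unfolding substitute_def subst_monom_def[symmetric] using assms
  by (intro sum.mono_neutral_left) (auto simp: in_keys_iff)

lemma substitute_0 [simp]: "substitute \<sigma> 0 = 0"
  by (simp add: substitute_def)

lemma substitute_monom: "substitute \<sigma> (monom m c) = of_int c * subst_monom \<sigma> m"
  using substitute_superset[of "{m}" "monom m c" \<sigma>] by simp

lemma substitute_add: "substitute \<sigma> (P + Q) = substitute \<sigma> P + substitute \<sigma> Q"
proof -
  let ?A = "Poly_Mapping.keys P \<union> Poly_Mapping.keys Q"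
  have "substitute \<sigma> R = (\<Sum>m\<in>?A. of_int (coeff R m) * subst_monom \<sigma> m)"
    if "R \<in> {P, Q, P + Q}" for R
    by (rule substitute_superset) (use that keys_add[of P Q] in auto)
  then show ?thesis
    by (simp add: lookup_add distrib_right sum.distrib)
qed

lemma substitute_mult: "substitute \<sigma> (P * Q) = substitute \<sigma> P * substitute \<sigma> Q"
proof (rule additive_eqI[where P = Q])
  show "substitute \<sigma> (P * monom m c) = substitute \<sigma> P * substitute \<sigma> (monom m c)" for m c
    by (rule additive_eqI[where P = P])
      (simp_all add: substitute_monom substitute_add subst_monom_add mult_single distrib_right)
qed (simp_all add: substitute_add distrib_left)

lemma substitute_1 [simp]: "substitute \<sigma> 1 = 1"
  using substitute_monom[of \<sigma> 0 1] by simp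

lemma substitute_uminus: "substitute \<sigma> (- P) = - substitute \<sigma> P"
  using substitute_add[of \<sigma> P "- P"] by (simp add: add_eq_0_iff)

lemma substitute_diff: "substitute \<sigma> (P - Q) = substitute \<sigma> P - substitute \<sigma> Q"
  using substitute_add[of \<sigma> P "- Q"] by (simp add: substitute_uminus)

lemma substitute_prod: "substitute \<sigma> (\<Prod>a\<in>A. f a) = (\<Prod>a\<in>A. substitute \<sigma> (f a))"
  by (induction A rule: infinite_finite_induct) (simp_all add: substitute_mult)

lemma substitute_power: "substitute \<sigma> (P ^ k) = substitute \<sigma> P ^ k"
  by (induction k) (simp_all add: substitute_mult)

lemma substitute_of_int [simp]: "substitute \<sigma> (of_int c) = of_int c"
proof -
  have "monom 0 c = of_int c"
    using single_of_int[of c] by (metis of_int_eq_id id_apply)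
  then show ?thesis
    using substitute_monom[of \<sigma> 0 c] by simp
qed

lemma substitute_Var [simp]: "substitute \<sigma> (Var v) = \<sigma> v"
  by (simp add: Var_def substitute_monom)

lemmas substitute_hom = substitute_add substitute_diff substitute_mult substitute_prod
  substitute_power

lemma Var_power: "Var v ^ k = monom (Poly_Mapping.single v k) 1"
  by (induction k) (simp_all add: Var_def mult_single single_add[symmetric] flip: single_one)

lemma prod_monom: "(\<Prod>a\<in>A. monom (f a) 1) = monom (\<Sum>a\<in>A. f a) 1"
  by (induction A rule: infinite_finite_induct) (simp_all add: mult_single)

lemma subst_monom_Var: "subst_monom Var m = monom m 1"
proof -
  have "(\<Sum>v\<in>Poly_Mapping.keys m. Poly_Mapping.single v (expo m v)) = m"
    by (rule poly_mapping_eqI) (auto simp: lookup_sum lookup_single when_def in_keys_iff)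
  then show ?thesis
    by (simp add: subst_monom_def Var_power prod_monom)
qed

text \<open>Divisibility of \<open>P - s\<^sub>i P\<close> by \<open>x\<^sub>i - x\<^sub>i\<^sub>+\<^sub>1\<close> is inherited by sums and products, so induction over
  the construction of \<open>P\<close> fits it better than an expansion into monomials.\<close>

lemma poly_induct [case_names Int Var add mult]:
  assumes "\<And>c. T (of_int c)" "\<And>v. T (Var v)"
    "\<And>P Q. T P \<Longrightarrow> T Q \<Longrightarrow> T (P + Q)" "\<And>P Q. T P \<Longrightarrow> T Q \<Longrightarrow> T (P * Q)"
  shows "T P"
proof -
  have T_prod: "T (\<Prod>a\<in>A. f a)" if "\<And>a. T (f a)" for f :: "var \<Rightarrow> poly_xy" and A
    using assms(1)[of 1] that by (induction A rule: infinite_finite_induct) (auto intro: assms)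
  have T_sum: "T (\<Sum>a\<in>A. f a)" if "\<And>a. T (f a)" for f :: "(var \<Rightarrow>\<^sub>0 nat) \<Rightarrow> poly_xy" and A
    using assms(1)[of 0] that by (induction A rule: infinite_finite_induct) (auto intro: assms)
  have T_pow: "T (Var v ^ k)" for v k
    using assms(1)[of 1] by (induction k) (auto intro: assms)
  have "monom m c = of_int c * (\<Prod>v\<in>Poly_Mapping.keys m. Var v ^ expo m v)" for m c
    by (simp add: subst_monom_Var[unfolded subst_monom_def] mult_single flip: single_of_int)
  then have "T (monom m c)" for m c
    using T_prod T_pow assms by metis
  then show ?thesis
    by (subst poly_eq_sum_monom) (rule T_sum)
qed

lemma coeff_Var_mult_add: "coeff (Var v * Q) (Poly_Mapping.single v 1 + m) = coeff Q m"
  by (rule additive_eqI[where P = Q])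
    (simp_all add: Var_def mult_single distrib_left lookup_add lookup_single when_def)

lemma coeff_Var_mult_0:
  assumes "expo m v = 0"
  shows "coeff (Var v * Q) m = 0"
proof (rule additive_eqI[where P = Q])
  show "coeff (Var v * monom m' c) m = 0" for m' c
    using assms by (auto simp: Var_def mult_single lookup_single when_def lookup_add)
qed (simp_all add: distrib_left lookup_add)

section \<open>Exchanging neighbouring x-variables\<close>

definition swap_var :: "nat \<Rightarrow> var \<Rightarrow> var" where
  "swap_var i = case_var (\<lambda>k. X (simple_transposition i k)) Y"

lemma swap_var_simps [simp]:
  "swap_var i (X k) = X (simple_transposition i k)" "swap_var i (Y j) = Y j"
  by (simp_all add: swap_var_def)

lemma swap_var_involutory [simp]: "swap_var i (swap_var i v) = v"
  by (cases v) simp_all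

lemma inj_swap_var [simp]: "inj (swap_var i)"
  by (metis injI swap_var_involutory)

text \<open>The exchange of \<open>x\<^sub>i\<close> and \<open>x\<^sub>i\<^sub>+\<^sub>1\<close> permutes monomials. Describing it on exponent vectors turns
  relations between exchanges into relations between permutations of variables.\<close>

definition swap_expo :: "nat \<Rightarrow> (var \<Rightarrow>\<^sub>0 nat) \<Rightarrow> (var \<Rightarrow>\<^sub>0 nat)" where
  "swap_expo i = Poly_Mapping.map_key (swap_var i)"

lemma expo_swap_expo [simp]: "expo (swap_expo i m) v = expo m (swap_var i v)"
  by (simp add: swap_expo_def map_key.rep_eq)

lemma swap_expo_involutory [simp]: "swap_expo i (swap_expo i m) = m"
  by (rule poly_mapping_eqI) simp

lemma swap_x_eq: "swap_x i = substitute (\<lambda>v. Var (swap_var i v))"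
  unfolding swap_x_def by (rule arg_cong[of _ _ substitute]) (auto split: var.split)

lemma swap_x_monom: "swap_x i (monom m c) = monom (swap_expo i m) c"
proof -
  have "swap_expo i m = (\<Sum>v\<in>Poly_Mapping.keys m. Poly_Mapping.single (swap_var i v) (expo m v))"
  proof (rule poly_mapping_eqI)
    fix u
    have "swap_var i v = u \<longleftrightarrow> v = swap_var i u" for v
      by auto
    then show "expo (swap_expo i m) u =
        expo (\<Sum>v\<in>Poly_Mapping.keys m. Poly_Mapping.single (swap_var i v) (expo m v)) u"
      by (auto simp: lookup_sum lookup_single when_def in_keys_iff)
  qed
  then have "subst_monom (\<lambda>v. Var (swap_var i v)) m = monom (swap_expo i m) 1"
    by (simp add: subst_monom_def Var_power prod_monom)
  then show ?thesis
    by (simp add: swap_x_eq substitute_monom mult_single flip: single_of_int)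
qed

lemma coeff_swap_x: "coeff (swap_x i P) m = coeff P (swap_expo i m)"
proof (rule additive_eqI[where P = P])
  show "coeff (swap_x i (monom m' c)) m = coeff (monom m' c) (swap_expo i m)" for m' c
    using swap_expo_involutory by (auto simp: swap_x_monom lookup_single when_def)
qed (simp_all add: swap_x_eq substitute_hom lookup_add)

lemma swap_x_hom:
  "swap_x i (P + Q) = swap_x i P + swap_x i Q"
  "swap_x i (P - Q) = swap_x i P - swap_x i Q"
  "swap_x i (P * Q) = swap_x i P * swap_x i Q"
  "swap_x i (\<Prod>a\<in>A. f a) = (\<Prod>a\<in>A. swap_x i (f a))"
  by (simp_all add: swap_x_eq substitute_hom)

lemma swap_x_simps [simp]:
  "swap_x i (of_int c) = of_int c"
  "swap_x i (xvar k) = xvar (simple_transposition i k)"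
  "swap_x i (yvar j) = yvar j"
  by (simp_all add: swap_x_eq)

lemma swap_x_relations:
  "swap_x i (swap_x i P) = P"
  "Suc i < j \<Longrightarrow> swap_x i (swap_x j P) = swap_x j (swap_x i P)"
  "swap_x i (swap_x (Suc i) (swap_x i P)) = swap_x (Suc i) (swap_x i (swap_x (Suc i) P))"
proof -
  show "swap_x i (swap_x i P) = P"
    by (rule poly_mapping_eqI) (simp add: coeff_swap_x)
  show "swap_x i (swap_x j P) = swap_x j (swap_x i P)" if "Suc i < j"
  proof (rule poly_mapping_eqI)
    fix m
    have "swap_expo j (swap_expo i m) = swap_expo i (swap_expo j m)"
      by (rule poly_mapping_eqI)
        (use that in \<open>auto simp: swap_var_def transpose_def split: var.split\<close>)
    then show "coeff (swap_x i (swap_x j P)) m = coeff (swap_x j (swap_x i P)) m"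
      by (simp add: coeff_swap_x)
  qed
  show "swap_x i (swap_x (Suc i) (swap_x i P)) = swap_x (Suc i) (swap_x i (swap_x (Suc i) P))"
  proof (rule poly_mapping_eqI)
    fix m
    have "swap_expo i (swap_expo (Suc i) (swap_expo i m)) =
      swap_expo (Suc i) (swap_expo i (swap_expo (Suc i) m))"
      by (rule poly_mapping_eqI) (auto simp: swap_var_def transpose_def split: var.split)
    then show "coeff (swap_x i (swap_x (Suc i) (swap_x i P))) m =
      coeff (swap_x (Suc i) (swap_x i (swap_x (Suc i) P))) m"
      by (simp add: coeff_swap_x)
  qed
qed

lemma Var_eq_iff: "Var u = Var v \<longleftrightarrow> u = v"
proof
  assume "Var u = Var v"
  then have "coeff (Var u) (Poly_Mapping.single u 1) = coeff (Var v) (Poly_Mapping.single u 1)"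
    by (rule arg_cong)
  then have "Poly_Mapping.single v (1 :: nat) = Poly_Mapping.single u 1"
    by (simp add: Var_def lookup_single when_def split: if_splits)
  then have "expo (Poly_Mapping.single v 1) u = expo (Poly_Mapping.single u 1) u"
    by (rule arg_cong)
  then show "u = v"
    by (simp add: lookup_single when_def split: if_splits)
qed simp

lemma xvar_diff_nonzero: "i \<noteq> j \<Longrightarrow> xvar i - xvar j \<noteq> 0"
  by (simp add: Var_eq_iff)

text \<open>The definite description in \<^const>\<open>divided_difference\<close> denotes because the quotient exists. The
  product case is the twisted Leibniz rule
  \<open>PQ - s(P)s(Q) = (P - s(P)) Q + s(P) (Q - s(Q))\<close>.\<close>

lemma divided_difference_mult:
  "(xvar i - xvar (Suc i)) * divided_difference i P = P - swap_x i P"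
proof -
  have "\<exists>Q. (xvar i - xvar (Suc i)) * Q = P - swap_x i P"
  proof (induction P rule: poly_induct)
    case (Int c)
    show ?case by (intro exI[of _ 0]) simp
  next
    case (Var v)
    show ?case
    proof (cases "v = X i \<or> v = X (Suc i)")
      case True
      then show ?thesis
        by (intro exI[of _ "if v = X i then 1 else - 1"]) auto
    next
      case False
      then show ?thesis
        by (intro exI[of _ 0]) (cases v; auto simp: swap_x_simps transpose_def)
    qed
  next
    case (add P Q)
    then obtain P' Q' where "(xvar i - xvar (Suc i)) * P' = P - swap_x i P"
      "(xvar i - xvar (Suc i)) * Q' = Q - swap_x i Q" by blast
    then show ?case
      by (intro exI[of _ "P' + Q'"]) (simp add: swap_x_hom(1) distrib_left)
  next
    case (mult P Q)
    then obtain P' Q' where quot: "(xvar i - xvar (Suc i)) * P' = P - swap_x i P"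
      "(xvar i - xvar (Suc i)) * Q' = Q - swap_x i Q" by blast
    have "d * (P' * Q + swap_x i P * Q') = (d * P') * Q + swap_x i P * (d * Q')" for d
      by (simp add: algebra_simps)
    then have "(xvar i - xvar (Suc i)) * (P' * Q + swap_x i P * Q') =
        (P - swap_x i P) * Q + swap_x i P * (Q - swap_x i Q)"
      by (simp only: quot)
    also have "\<dots> = P * Q - swap_x i (P * Q)"
      by (simp add: swap_x_hom(3) algebra_simps)
    finally show ?case by blast
  qed
  then show ?thesis
    using divided_difference_eqI by blast
qed

text \<open>Numerator and denominator of the quotient are both anti-invariant under the exchange.\<close>

lemma swap_x_divided_difference: "swap_x i (divided_difference i P) = divided_difference i P"
proof -
  let ?d = "xvar i - xvar (Suc i)" and ?Q = "divided_difference i P"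
  have "swap_x i (?d * ?Q) = swap_x i (P - swap_x i P)"
    by (simp add: divided_difference_mult)
  then have "- (?d * swap_x i ?Q) = - (P - swap_x i P)"
    by (simp add: swap_x_hom swap_x_relations algebra_simps)
  then have "?d * swap_x i ?Q = ?d * ?Q"
    by (simp only: neg_equal_iff_equal divided_difference_mult)
  then show ?thesis
    using xvar_diff_nonzero[of i "Suc i"] by (simp only: mult_cancel_left) simp
qed

lemma divided_difference_eq_0_iff: "divided_difference i P = 0 \<longleftrightarrow> swap_x i P = P"
  using divided_difference_mult[of i P] divided_difference_eqI[of i 0 P] by auto

text \<open>Multiplied by both denominators, either side becomes \<open>P - s\<^sub>i P - s\<^sub>j P + s\<^sub>i s\<^sub>j P\<close>.\<close>

lemma divided_difference_comm:
  assumes "Suc i < j"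
  shows "divided_difference i (divided_difference j P) =
         divided_difference j (divided_difference i P)"
proof -
  let ?s = "swap_x i" and ?t = "swap_x j"
  define a b where "a = xvar i - xvar (Suc i)" and "b = xvar j - xvar (Suc j)"
  have sw: "?s b = b" "?t a = a"
    using assms by (simp_all add: a_def b_def swap_x_hom(2) transpose_def)
  have nz: "a \<noteq> 0" "b \<noteq> 0"
    by (simp_all add: a_def b_def Var_eq_iff)
  have da: "a * divided_difference i Q = Q - ?s Q"
    and db: "b * divided_difference j Q = Q - ?t Q" for Q
    by (simp_all only: a_def b_def divided_difference_mult)
  have s_db: "b * ?s (divided_difference j P) = ?s P - ?s (?t P)"
    using arg_cong[OF db[of P], of ?s] by (simp only: swap_x_hom sw)
  have t_da: "a * ?t (divided_difference i P) = ?t P - ?t (?s P)"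
    using arg_cong[OF da[of P], of ?t] by (simp only: swap_x_hom sw)
  have "a * b * divided_difference i (divided_difference j P) =
      b * (a * divided_difference i (divided_difference j P))"
    by (simp only: mult_ac)
  also have "\<dots> = P - ?t P - (?s P - ?s (?t P))"
    by (simp only: da right_diff_distrib db s_db)
  also have "\<dots> = P - ?s P - (?t P - ?t (?s P))"
    by (simp add: swap_x_relations(2)[OF assms])
  also have "\<dots> = a * (b * divided_difference j (divided_difference i P))"
    by (simp only: db right_diff_distrib da t_da)
  finally have "a * b * divided_difference i (divided_difference j P) =
      a * b * divided_difference j (divided_difference i P)"
    by (simp only: mult_ac)
  then show ?thesis
    using nz by simp
qed

text \<open>Both sides are the antisymmetrization of \<open>P\<close> over the permutations of \<open>x\<^sub>i, x\<^sub>i\<^sub>+\<^sub>1, x\<^sub>i\<^sub>+\<^sub>2\<close>,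
  divided by the product \<open>abc\<close> of the three differences of these variables. The
  exchanges \<open>s\<close> and \<open>t\<close> permute \<open>a, b, c\<close> up to sign, so two successive quotients have the common
  denominator \<open>abc\<close>, and \<open>c = a + b\<close> makes the third denominator cancel.\<close>

lemma divided_difference_braid:
  "divided_difference i (divided_difference (Suc i) (divided_difference i P)) =
   divided_difference (Suc i) (divided_difference i (divided_difference (Suc i) P))"
proof -
  let ?s = "swap_x i" and ?t = "swap_x (Suc i)"
  define a b c where "a = xvar i - xvar (Suc i)" and "b = xvar (Suc i) - xvar (Suc (Suc i))"
    and "c = xvar i - xvar (Suc (Suc i))"
  have sw: "?s a = - a" "?s b = c" "?s c = b" "?t a = c" "?t b = - b" "?t c = a"
    by (simp_all add: a_def b_def c_def swap_x_hom transpose_def)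
  have nz: "a \<noteq> 0" "b \<noteq> 0" "c \<noteq> 0"
    by (simp_all add: a_def b_def c_def Var_eq_iff)
  have c: "c = a + b"
    by (simp add: a_def b_def c_def)
  have da: "a * divided_difference i Q = Q - ?s Q"
    and db: "b * divided_difference (Suc i) Q = Q - ?t Q" for Q
    by (simp_all only: a_def b_def divided_difference_mult)
  define P1 where "P1 = divided_difference i P"
  define P2 where "P2 = divided_difference (Suc i) P1"
  define P3 where "P3 = divided_difference i P2"
  define R1 where "R1 = divided_difference (Suc i) P"
  define R2 where "R2 = divided_difference i R1"
  define R3 where "R3 = divided_difference (Suc i) R2"
  have P1: "a * P1 = P - ?s P" and P2: "b * P2 = P1 - ?t P1" and P3: "a * P3 = P2 - ?s P2"
    and R1: "b * R1 = P - ?t P" and R2: "a * R2 = R1 - ?s R1" and R3: "b * R3 = R2 - ?t R2"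
    unfolding P1_def P2_def P3_def R1_def R2_def R3_def by (simp_all only: da db)
  have tP1: "c * ?t P1 = ?t P - ?t (?s P)"
    using arg_cong[OF P1, of ?t] by (simp only: swap_x_hom sw)
  have sR1: "c * ?s R1 = ?s P - ?s (?t P)"
    using arg_cong[OF R1, of ?s] by (simp only: swap_x_hom sw)
  have abc_P2: "a * b * c * P2 = c * (P - ?s P) - a * (?t P - ?t (?s P))"
  proof -
    have "a * b * c * P2 = c * a * (b * P2)" by (simp only: mult_ac)
    also have "\<dots> = c * (a * P1) - a * (c * ?t P1)" by (simp only: P2) (simp add: algebra_simps)
    finally show ?thesis by (simp only: P1 tP1)
  qed
  have abc_R2: "a * b * c * R2 = c * (P - ?t P) - b * (?s P - ?s (?t P))"
  proof -
    have "a * b * c * R2 = c * b * (a * R2)" by (simp only: mult_ac)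
    also have "\<dots> = c * (b * R1) - b * (c * ?s R1)" by (simp only: R2) (simp add: algebra_simps)
    finally show ?thesis by (simp only: R1 sR1)
  qed
  have abc_sP2: "a * b * c * ?s P2 = b * (P - ?s P) - a * (?s (?t P) - ?s (?t (?s P)))"
    using arg_cong[OF abc_P2, of ?s]
    by (simp add: swap_x_hom sw swap_x_relations(1) algebra_simps)
  have abc_tR2: "a * b * c * ?t R2 = a * (P - ?t P) - b * (?t (?s P) - ?t (?s (?t P)))"
    using arg_cong[OF abc_R2, of ?t]
    by (simp add: swap_x_hom sw swap_x_relations(1) algebra_simps)
  let ?A = "P - ?s P - ?t P + ?s (?t P) + ?t (?s P) - ?s (?t (?s P))"
  have "a * (a * b * c * P3) = a * ?A"
  proof -
    have "a * (a * b * c * P3) = a * b * c * (a * P3)" by (simp only: mult_ac)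
    also have "\<dots> = a * b * c * P2 - a * b * c * ?s P2"
      by (simp only: P3 right_diff_distrib)
    also have "\<dots> = a * ?A"
      by (simp only: abc_P2 abc_sP2) (simp add: c algebra_simps)
    finally show ?thesis .
  qed
  moreover have "b * (a * b * c * R3) = b * ?A"
  proof -
    have "b * (a * b * c * R3) = a * b * c * (b * R3)" by (simp only: mult_ac)
    also have "\<dots> = a * b * c * R2 - a * b * c * ?t R2"
      by (simp only: R3 right_diff_distrib)
    also have "\<dots> = b * ?A"
      by (simp only: abc_R2 abc_tR2 swap_x_relations(3)) (simp add: c algebra_simps)
    finally show ?thesis .
  qed
  ultimately have "a * b * c * P3 = a * b * c * R3"
    using nz by (metis mult_cancel_left)
  then show ?thesis
    unfolding P1_def P2_def P3_def R1_def R2_def R3_def using nz by simp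
qed

section \<open>Specialization of the y-variables to zero\<close>

lemma set_y_zero_hom:
  "set_y_zero (P - Q) = set_y_zero P - set_y_zero Q"
  "set_y_zero (P * Q) = set_y_zero P * set_y_zero Q"
  "set_y_zero (\<Prod>a\<in>A. f a) = (\<Prod>a\<in>A. set_y_zero (f a))"
  by (simp_all add: set_y_zero_def substitute_hom)

lemma set_y_zero_simps [simp]:
  "set_y_zero 1 = 1"
  "set_y_zero (xvar k) = xvar k"
  "set_y_zero (yvar j) = 0"
  by (simp_all add: set_y_zero_def)

lemma coeff_set_y_zero:
  assumes "\<And>j. expo m (Y j) = 0"
  shows "coeff (set_y_zero P) m = coeff P m"
proof (rule additive_eqI[where P = P])
  show "coeff (set_y_zero (monom m' c)) m = coeff (monom m' c) m" for m' c
  proof (cases "\<exists>j. expo m' (Y j) \<noteq> 0")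
    case True
    then obtain j where j: "expo m' (Y j) \<noteq> 0" by blast
    then have "subst_monom (case_var xvar (\<lambda>j. 0)) m' = 0"
      unfolding subst_monom_def by (intro prod_zero bexI[of _ "Y j"]) (auto simp: in_keys_iff)
    moreover have "m \<noteq> m'"
      using j assms by auto
    ultimately show ?thesis
      by (simp add: set_y_zero_def substitute_monom lookup_single when_def)
  next
    case False
    then have "subst_monom (case_var xvar (\<lambda>j. 0)) m' = subst_monom Var m'"
      unfolding subst_monom_def by (intro prod.cong) (auto simp: in_keys_iff split: var.split)
    also have "\<dots> = monom m' 1"
      by (rule subst_monom_Var)
    finally show ?thesis
      by (simp add: set_y_zero_def substitute_monom mult_single flip: single_of_int)
  qed
qed (simp_all add: set_y_zero_def substitute_hom lookup_add)

section \<open>Lehmer codes and ascents\<close>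

definition lehmer_code :: "nat \<Rightarrow> (nat \<Rightarrow> nat) \<Rightarrow> nat \<Rightarrow> nat" where
  "lehmer_code n w i = card {j \<in> {i<..n}. w j < w i}"

lemma code_le: "lehmer_code n w i \<le> n - i"
proof -
  have "card {j \<in> {i<..n}. w j < w i} \<le> card {i<..n}"
    by (rule card_mono) auto
  then show ?thesis
    by (simp add: lehmer_code_def)
qed

lemma perm_length_eq_sum_code: "perm_length n w = (\<Sum>i\<in>{1..n}. lehmer_code n w i)"
proof -
  have "{(i, j). 1 \<le> i \<and> i < j \<and> j \<le> n \<and> w i > w j} =
      (SIGMA i:{1..n}. {j \<in> {i<..n}. w j < w i})"
    by auto
  then show ?thesis
    by (simp add: perm_length_def lehmer_code_def)
qed

lemma perm_length_le: "perm_length n w \<le> n * n"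
proof -
  have "(\<Sum>i\<in>{1..n}. lehmer_code n w i) \<le> (\<Sum>i\<in>{1..n}. n)"
    by (rule sum_mono) (meson code_le diff_le_self le_trans)
  then show ?thesis
    by (simp add: perm_length_eq_sum_code)
qed

text \<open>The permutation \<open>w s\<^sub>i\<close> is longer than \<open>w\<close> exactly at the ascents, and there \<open>\<SS>\<^sub>w\<close> is the divided
  difference of \<open>\<SS>\<close> at \<open>w s\<^sub>i\<close>.\<close>

definition ascent :: "nat \<Rightarrow> (nat \<Rightarrow> nat) \<Rightarrow> nat \<Rightarrow> bool" where
  "ascent n w i \<longleftrightarrow> 1 \<le> i \<and> i < n \<and> w i < w (Suc i)"

lemma not_ascent_iff:
  assumes "w permutes {1..n}" "1 \<le> i" "i < n"
  shows "\<not> ascent n w i \<longleftrightarrow> w (Suc i) < w i"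
  using assms permutes_inj[OF assms(1)] n_not_Suc_n
  unfolding ascent_def by (metis injD linorder_neqE_nat not_less_iff_gr_or_eq)

lemma permutes_comp_simple_transposition:
  assumes "w permutes {1..n}" "1 \<le> i" "i < n"
  shows "w \<circ> simple_transposition i permutes {1..n}"
  using assms by (intro permutes_compose permutes_swap_id) auto

text \<open>Exchanging the values at an ascent creates the single inversion \<open>(i, i + 1)\<close>. The two neighbouring
  code entries trade places, and the larger value, now at position \<open>i\<close>, gains that inversion.\<close>

lemma code_ascent:
  assumes "ascent n w i"
  shows "lehmer_code n (w \<circ> simple_transposition i) i = Suc (lehmer_code n w (Suc i))" (is ?A)
    and "lehmer_code n (w \<circ> simple_transposition i) (Suc i) = lehmer_code n w i" (is ?B)
    and "k \<noteq> i \<Longrightarrow> k \<noteq> Suc i \<Longrightarrow> lehmer_code n (w \<circ> simple_transposition i) k = lehmer_code n w k"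
proof -
  let ?v = "w \<circ> simple_transposition i"
  have i: "i < n" "w i < w (Suc i)"
    using assms by (auto simp: ascent_def)
  have "{j \<in> {i<..n}. ?v j < ?v i} = insert (Suc i) {j \<in> {Suc i<..n}. w j < w (Suc i)}"
  proof (rule set_eqI)
    show "j \<in> {j \<in> {i<..n}. ?v j < ?v i} \<longleftrightarrow>
        j \<in> insert (Suc i) {j \<in> {Suc i<..n}. w j < w (Suc i)}" for j
      using i by (cases "j = Suc i") (auto simp: transpose_def)
  qed
  then show ?A
    by (simp add: lehmer_code_def)
  have "{j \<in> {Suc i<..n}. ?v j < ?v (Suc i)} = {j \<in> {i<..n}. w j < w i}"
  proof (rule Collect_cong)
    show "j \<in> {Suc i<..n} \<and> ?v j < ?v (Suc i) \<longleftrightarrow> j \<in> {i<..n} \<and> w j < w i" for j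
      using i by (cases "j = Suc i") (auto simp: transpose_def)
  qed
  then show ?B
    by (simp add: lehmer_code_def)
  show "lehmer_code n ?v k = lehmer_code n w k" if k: "k \<noteq> i" "k \<noteq> Suc i"
  proof -
    have vk: "?v k = w k"
      using k by (simp add: transpose_def)
    have range: "simple_transposition i j \<in> {k<..n} \<longleftrightarrow> j \<in> {k<..n}" for j
      using k i by (auto simp: transpose_def)
    have "{j \<in> {k<..n}. ?v j < ?v k} = simple_transposition i -` {j \<in> {k<..n}. w j < w k}"
      unfolding vk vimage_def mem_Collect_eq range by simp
    moreover have "card (simple_transposition i -` B) = card B" for B
      by (rule card_vimage_inj[OF inj_transpose]) (simp add: surj_transpose)
    ultimately show ?thesis
      by (simp only: lehmer_code_def)
  qed
qed

lemma perm_length_ascent: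
  assumes "ascent n w i"
  shows "perm_length n (w \<circ> simple_transposition i) = Suc (perm_length n w)"
proof -
  have i: "i \<in> {1..n}" "Suc i \<in> {1..n}" "i \<noteq> Suc i"
    using assms by (auto simp: ascent_def)
  have split: "(\<Sum>k\<in>{1..n}. f k) = f i + (f (Suc i) + (\<Sum>k\<in>{1..n} - {i} - {Suc i}. f k))"
    for f :: "nat \<Rightarrow> nat"
    using i by (simp add: sum.remove[of _ i] sum.remove[of _ "Suc i"])
  have "(\<Sum>k\<in>{1..n} - {i} - {Suc i}. lehmer_code n (w \<circ> simple_transposition i) k) =
      (\<Sum>k\<in>{1..n} - {i} - {Suc i}. lehmer_code n w k)"
    by (rule sum.cong) (use code_ascent(3)[OF assms] in auto)
  then show ?thesis
    unfolding perm_length_eq_sum_code split using code_ascent(1,2)[OF assms] by simp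
qed

lemma ascent_descent_swap:
  assumes "1 \<le> i" "i < n" "w (Suc i) < w i"
  shows "ascent n (w \<circ> simple_transposition i) i"
  using assms by (simp add: ascent_def)

lemma comp_simple_transposition_twice [simp]:
  "w \<circ> simple_transposition i \<circ> simple_transposition i = w"
  by (simp add: fun_eq_iff)

lemma perm_length_decreases_iff:
  assumes "w permutes {1..n}" "1 \<le> i" "i < n"
  shows "perm_length n (w \<circ> simple_transposition i) < perm_length n w \<longleftrightarrow> \<not> ascent n w i"
proof (cases "ascent n w i")
  case True
  then show ?thesis
    by (simp add: perm_length_ascent)
next
  case False
  then have "ascent n (w \<circ> simple_transposition i) i"
    using not_ascent_iff[OF assms] assms by (simp add: ascent_descent_swap)
  from perm_length_ascent[OF this] False show ?thesis
    by simp
qed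

lemma code_ascent_iff:
  assumes "w permutes {1..n}" "1 \<le> i" "i < n"
  shows "ascent n w i \<longleftrightarrow> lehmer_code n w i \<le> lehmer_code n w (Suc i)"
proof
  have le: "lehmer_code n v i \<le> lehmer_code n v (Suc i)" if "ascent n v i" for v
  proof -
    have v: "v i < v (Suc i)"
      using that by (simp add: ascent_def)
    have "j \<noteq> Suc i" if "v j < v i" for j
      using that v by auto
    then have "{j \<in> {i<..n}. v j < v i} \<subseteq> {j \<in> {Suc i<..n}. v j < v (Suc i)}"
      using v by (auto intro: Suc_lessI)
    then show ?thesis
      unfolding lehmer_code_def by (intro card_mono) auto
  qed
  show "lehmer_code n w i \<le> lehmer_code n w (Suc i)" if "ascent n w i"
    using le that .
  show "ascent n w i" if "lehmer_code n w i \<le> lehmer_code n w (Suc i)"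
  proof (rule ccontr)
    assume "\<not> ascent n w i"
    then have "ascent n (w \<circ> simple_transposition i) i"
      using not_ascent_iff[OF assms] assms by (simp add: ascent_descent_swap)
    from code_ascent(1,2)[OF this] le[OF this] show False
      using that by simp
  qed
qed

text \<open>Downward induction on the length: lengths are bounded by \<open>n * n\<close>, and the longest permutation is
  the base.\<close>

lemma perm_length_induct [consumes 1, case_names longer]:
  assumes "w permutes {1..n}"
    and longer: "\<And>w. w permutes {1..n} \<Longrightarrow>
      (\<And>v. v permutes {1..n} \<Longrightarrow> perm_length n w < perm_length n v \<Longrightarrow> T v) \<Longrightarrow> T w"
  shows "T w"
  using assms(1)
proof (induction "n * n - perm_length n w" arbitrary: w rule: less_induct)
  case less
  show ?case
  proof (rule longer[OF less.prems])
    fix v assume v: "v permutes {1..n}" "perm_length n w < perm_length n v"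
    then have "n * n - perm_length n v < n * n - perm_length n w"
      using perm_length_le[of n v] by simp
    then show "T v"
      using less.hyps v(1) by blast
  qed
qed

lemma permutes_ascent:
  assumes "w permutes {1..n}" "ascent n w i"
  shows "w \<circ> simple_transposition i permutes {1..n}"
  using assms permutes_comp_simple_transposition unfolding ascent_def by blast

lemma ascent_induct [consumes 1, case_names step]:
  assumes "w permutes {1..n}"
    and step: "\<And>w. w permutes {1..n} \<Longrightarrow>
      (\<And>i. ascent n w i \<Longrightarrow> T (w \<circ> simple_transposition i)) \<Longrightarrow> T w"
  shows "T w"
  using assms(1)
proof (induction w rule: perm_length_induct)
  case (longer w)
  then show ?case
    using step permutes_ascent perm_length_ascent by (metis lessI)
qed

section \<open>Dominant permutations are those with decreasing Lehmer code\<close>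

text \<open>The position of an element in the sorted list counts the smaller elements. This is the link
  between the recursion defining \<^const>\<open>dominant_perm\<close>, which selects a remaining value by its
  position, and the code, which counts the smaller values that remain.\<close>

lemma card_less_nth_sorted_list_of_set:
  fixes A :: "nat set"
  assumes "finite A" "k < card A"
  shows "sorted_list_of_set A ! k \<in> A"
    and "card {a \<in> A. a < sorted_list_of_set A ! k} = k"
proof -
  let ?l = "sorted_list_of_set A"
  have len: "k < length ?l" "set ?l = A" "distinct ?l" "sorted_wrt (<) ?l"
    using assms by simp_all
  then show "?l ! k \<in> A"
    by (metis nth_mem)
  have less_iff: "?l ! a < ?l ! b \<longleftrightarrow> a < b" if "a < length ?l" "b < length ?l" for a b
    using that len(4) by (metis linorder_neqE_nat order_less_asym sorted_wrt_nth_less)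
  have "{a \<in> A. a < ?l ! k} = (\<lambda>j. ?l ! j) ` {..<k}"
  proof safe
    fix a assume "a \<in> A" "a < ?l ! k"
    then obtain j where "j < length ?l" "a = ?l ! j"
      using len(2) by (metis in_set_conv_nth)
    then show "a \<in> (\<lambda>j. ?l ! j) ` {..<k}"
      using less_iff len(1) \<open>a < ?l ! k\<close> by auto
  next
    fix j assume "j < k"
    then have j: "j < length ?l"
      using len(1) by simp
    show "?l ! j \<in> A"
      using nth_mem[OF j] len(2) by simp
    show "?l ! j < ?l ! k"
      using less_iff[OF j len(1)] \<open>j < k\<close> by simp
  qed
  moreover have "inj_on (\<lambda>j. ?l ! j) {..<k}"
    using len(1,3) by (auto simp: inj_on_def nth_eq_iff_index_eq)
  ultimately show "card {a \<in> A. a < ?l ! k} = k"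
    by (simp add: card_image)
qed

lemma card_less_inj:
  fixes A :: "nat set"
  assumes "finite A" "x \<in> A" "y \<in> A" "card {a \<in> A. a < x} = card {a \<in> A. a < y}"
  shows "x = y"
proof -
  have "card {a \<in> A. a < x} < card {a \<in> A. a < y}" if "x < y" "x \<in> A" for x y
  proof (rule psubset_card_mono)
    have "{a \<in> A. a < x} \<subseteq> {a \<in> A. a < y}" "x \<in> {a \<in> A. a < y}" "x \<notin> {a \<in> A. a < x}"
      using that by auto
    then show "{a \<in> A. a < x} \<subset> {a \<in> A. a < y}"
      by (metis psubsetI)
  qed (use assms(1) in simp)
  from this[of x y] this[of y x] show ?thesis
    using assms by (cases x y rule: linorder_cases) simp_all
qed

text \<open>The values not used before position \<open>i\<close> are those taken from position \<open>i\<close> on, and the code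
  entry at \<open>i\<close> is the rank of \<open>w i\<close> among them.\<close>

lemma remaining_values:
  assumes "w permutes {1..n}" "i \<in> {1..n}"
  shows "{1..n} - w ` {1..<i} = w ` {i..n}" "lehmer_code n w i = card {a \<in> w ` {i..n}. a < w i}"
    "card (w ` {i..n}) = Suc (n - i)"
proof -
  have inj: "inj w"
    using assms(1) by (rule permutes_inj)
  have "{1..n} - {1..<i} = {i..n}"
    using assms(2) by auto
  then show "{1..n} - w ` {1..<i} = w ` {i..n}"
    using image_set_diff[OF inj, of "{1..n}" "{1..<i}"] permutes_image[OF assms(1)] by simp
  have "{a \<in> w ` {i..n}. a < w i} = w ` {j \<in> {i<..n}. w j < w i}"
    by (auto simp: le_less)
  then show "lehmer_code n w i = card {a \<in> w ` {i..n}. a < w i}"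
    using inj by (simp add: lehmer_code_def card_image inj_on_subset)
  show "card (w ` {i..n}) = Suc (n - i)"
    using inj assms(2) by (simp add: card_image inj_on_subset Suc_diff_le)
qed

lemma dominant_perm_at:
  assumes "i \<in> {1..n}"
  shows "dominant_perm n lam i =
    sorted_list_of_set ({1..n} - dominant_perm n lam ` {1..<i}) ! lam i"
  using assms by (subst dominant_perm.simps) simp

text \<open>In particular a permutation is determined by its code: the recursion rebuilds the values one after
  the other from their ranks among the remaining values.\<close>

lemma dominant_perm_eqI:
  assumes "w permutes {1..n}" "\<And>i. i \<in> {1..n} \<Longrightarrow> lam i = lehmer_code n w i"
  shows "dominant_perm n lam = w"
proof
  fix i
  show "dominant_perm n lam i = w i"
  proof (induction i rule: less_induct)
    case (less i)
    show ?case
    proof (cases "i \<in> {1..n}")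
      case True
      let ?A = "w ` {i..n}"
      have prev: "(\<lambda>j. dominant_perm n lam j) ` {1..<i} = w ` {1..<i}"
        by (rule image_cong) (use less in auto)
      then have eq: "dominant_perm n lam i = sorted_list_of_set ?A ! lehmer_code n w i"
        unfolding dominant_perm_at[OF True]
        by (simp only: remaining_values(1)[OF assms(1) True] assms(2)[OF True])
      have lt: "lehmer_code n w i < card ?A"
        using code_le[of n w i] remaining_values(3)[OF assms(1) True] by simp
      show ?thesis
        unfolding eq
        by (rule card_less_inj[of ?A])
          (use card_less_nth_sorted_list_of_set[OF _ lt] remaining_values(2)[OF assms(1) True] True in auto)
    next
      case False
      then show ?thesis
        using permutes_not_in[OF assms(1)] by (subst dominant_perm.simps) auto
    qed
  qed
qed

lemma code_dominant_perm:
  assumes "dominant_perm n lam permutes {1..n}" "i \<in> {1..n}" "lam i \<le> n - i"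
  shows "lehmer_code n (dominant_perm n lam) i = lam i"
proof -
  let ?w = "dominant_perm n lam" and ?A = "dominant_perm n lam ` {i..n}"
  have "?w i = sorted_list_of_set ?A ! lam i"
    unfolding dominant_perm_at[OF assms(2)] by (simp only: remaining_values(1)[OF assms(1,2)])
  moreover have "lam i < card ?A"
    using assms(3) remaining_values(3)[OF assms(1,2)] by simp
  ultimately show ?thesis
    using card_less_nth_sorted_list_of_set(2)[of ?A "lam i"] remaining_values(2)[OF assms(1,2)]
    by simp
qed

lemma dominant_iff_code_decreasing:
  assumes "w permutes {1..n}"
  shows "dominant n w \<longleftrightarrow> (\<forall>i. 1 \<le> i \<and> i < n \<longrightarrow> lehmer_code n w (Suc i) \<le> lehmer_code n w i)"
proof
  assume "dominant n w"
  then obtain lam where lam: "is_partition lam" "\<forall>i\<ge>1. lam i > 0 \<longrightarrow> lam i + i \<le> n"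
    "w = dominant_perm n lam"
    by (auto simp: dominant_def)
  have "lam i \<le> n - i" if "i \<in> {1..n}" for i
    using lam(2) that by (cases "lam i = 0") auto
  then have "lehmer_code n w i = lam i" if "i \<in> {1..n}" for i
    using code_dominant_perm assms lam(3) that by blast
  then show "\<forall>i. 1 \<le> i \<and> i < n \<longrightarrow> lehmer_code n w (Suc i) \<le> lehmer_code n w i"
    using lam(1) by (auto simp: is_partition_def)
next
  assume decr: "\<forall>i. 1 \<le> i \<and> i < n \<longrightarrow> lehmer_code n w (Suc i) \<le> lehmer_code n w i"
  define lam where "lam i = (if i \<in> {1..n} then lehmer_code n w i else 0)" for i
  have "is_partition lam"
    unfolding is_partition_def
  proof
    show "\<forall>i\<ge>1. lam (Suc i) \<le> lam i"
      using decr by (auto simp: lam_def)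
    show "finite {i. 1 \<le> i \<and> lam i > 0}"
      by (rule finite_subset[of _ "{1..n}"]) (auto simp: lam_def split: if_splits)
  qed
  moreover have "\<forall>i\<ge>1. lam i > 0 \<longrightarrow> lam i + i \<le> n"
  proof (intro allI impI)
    fix i assume "1 \<le> i" "lam i > 0"
    then show "lam i + i \<le> n"
      using code_le[of n w i] by (auto simp: lam_def split: if_splits)
  qed
  moreover have "w = dominant_perm n lam"
    using dominant_perm_eqI[OF assms, of lam] by (simp add: lam_def)
  ultimately show "dominant n w"
    by (auto simp: dominant_def)
qed

lemma longest_perm_permutes: "longest_perm n permutes {1..n}"
proof (rule bij_imp_permutes)
  show "bij_betw (longest_perm n) {1..n} {1..n}"
    by (rule bij_betw_byWitness[of _ "longest_perm n"]) (auto simp: longest_perm_def)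
qed (auto simp: longest_perm_def)

lemma not_ascent_longest_perm: "\<not> ascent n (longest_perm n) i"
  by (auto simp: ascent_def longest_perm_def)

text \<open>After the last ascent the values decrease, so every later position contributes an inversion. The
  version with an arbitrary starting position \<open>j\<close> serves both the longest permutation (\<open>j = 1\<close>) and
  the positions after the last ascent of an arbitrary permutation.\<close>

lemma code_no_ascent:
  assumes "w permutes {1..n}" "\<And>k. k \<ge> j \<Longrightarrow> \<not> ascent n w k" "1 \<le> j" "j \<le> i" "i \<le> n"
  shows "lehmer_code n w i = n - i"
  using assms(5,4)
proof (induction i rule: inc_induct)
  case base
  show ?case
    by (simp add: lehmer_code_def)
next
  case (step i)
  then have "lehmer_code n w (Suc i) < lehmer_code n w i"
    using code_ascent_iff[OF assms(1), of i] assms(2)[of i] assms(3) by simp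
  then show ?case
    using step code_le[of n w i] by simp
qed

lemma no_ascent_imp_longest:
  assumes "w permutes {1..n}" "\<And>i. \<not> ascent n w i"
  shows "w = longest_perm n"
proof -
  have "lehmer_code n v i = n - i" if "v \<in> {w, longest_perm n}" "i \<in> {1..n}" for v i
    using that code_no_ascent[of v n 1 i] assms longest_perm_permutes not_ascent_longest_perm
    by auto
  then have "dominant_perm n (\<lambda>i. n - i) = v" if "v \<in> {w, longest_perm n}" for v
    using that dominant_perm_eqI[of v n "\<lambda>i. n - i"] assms(1) longest_perm_permutes by auto
  then show ?thesis
    by (metis insertCI)
qed

section \<open>Existence of double Schubert polynomials\<close>

text \<open>For decreasing \<open>c\<close> this is the product over the cells \<open>(a, b)\<close> of the Young diagram with rows \<open>c\<close>.\<close>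

definition diagram_product :: "nat \<Rightarrow> (nat \<Rightarrow> nat) \<Rightarrow> poly_xy" where
  "diagram_product n c = (\<Prod>a\<in>{1..n}. \<Prod>b\<in>{1..c a}. xvar a - yvar b)"

lemma staircase_product:
  "(\<Prod>(i, j) \<in> {(i, j). 1 \<le> i \<and> 1 \<le> j \<and> i + j \<le> n}. xvar i - yvar j) =
   diagram_product n (\<lambda>i. n - i)"
proof -
  have "{(i, j). 1 \<le> i \<and> 1 \<le> j \<and> i + j \<le> n} = (SIGMA i:{1..n}. {1..n - i})"
    by auto
  then show ?thesis
    by (simp add: diagram_product_def prod.Sigma)
qed

text \<open>A fixed route from each permutation up to the longest one, through the first ascents, gives a
  candidate for the family.\<close>

function schubert :: "nat \<Rightarrow> (nat \<Rightarrow> nat) \<Rightarrow> poly_xy" where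
  "schubert n w =
     (if w permutes {1..n} \<and> (\<exists>i. ascent n w i)
      then divided_difference (LEAST i. ascent n w i)
        (schubert n (w \<circ> simple_transposition (LEAST i. ascent n w i)))
      else diagram_product n (\<lambda>i. n - i))"
  by pat_completeness auto
termination
proof (relation "measure (\<lambda>(n, w). n * n - perm_length n w)")
  fix n w
  assume "w permutes {1..n} \<and> (\<exists>i. ascent n w i)"
  then have "ascent n w (LEAST i. ascent n w i)"
    by (meson LeastI)
  from perm_length_ascent[OF this]
  show "((n, w \<circ> simple_transposition (LEAST i. ascent n w i)), n, w)
      \<in> measure (\<lambda>(n, w). n * n - perm_length n w)"
    using perm_length_le[of n "w \<circ> simple_transposition (LEAST i. ascent n w i)"] by simp
qed simp

declare schubert.simps [simp del]

text \<open>The candidate does not depend on the route. This is a diamond argument: let \<open>i\<close> be the first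
  ascent and \<open>j\<close> another one. If they are not adjacent, both routes can be continued to
  \<open>w s\<^sub>i s\<^sub>j = w s\<^sub>j s\<^sub>i\<close>; if \<open>j = i + 1\<close>, then \<open>w(i) < w(i+1) < w(i+2)\<close> and both can be continued to
  \<open>w s\<^sub>i s\<^sub>j s\<^sub>i = w s\<^sub>j s\<^sub>i s\<^sub>j\<close>. The induction hypothesis holds for all longer permutations, and the
  commutation and braid relations for divided differences close the diamond.\<close>

lemma schubert_ascent:
  assumes "w permutes {1..n}" "ascent n w j"
  shows "schubert n w = divided_difference j (schubert n (w \<circ> simple_transposition j))"
  using assms
proof (induction w arbitrary: j rule: perm_length_induct)
  case (longer w)
  define i where "i = (LEAST i. ascent n w i)"
  have i: "ascent n w i" "i \<le> j"
    using longer.prems unfolding i_def by (auto intro: LeastI Least_le)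
  have w_i: "schubert n w = divided_difference i (schubert n (w \<circ> simple_transposition i))"
    using longer.hyps longer.prems by (subst schubert.simps) (auto simp: i_def)
  have IH: "schubert n v = divided_difference k (schubert n (v \<circ> simple_transposition k))"
    if "v permutes {1..n}" "perm_length n w < perm_length n v" "ascent n v k" for v k
    using longer.IH that by blast
  have one: "v permutes {1..n} \<and> perm_length n w < perm_length n v"
    if "v = w \<circ> simple_transposition k" "ascent n w k" for v k
    using that permutes_ascent[OF longer.hyps] perm_length_ascent by simp
  have two: "v permutes {1..n} \<and> perm_length n w < perm_length n v"
    if "v = u \<circ> simple_transposition k" "ascent n u k"
      "u permutes {1..n} \<and> perm_length n w < perm_length n u" for u v k
    using that permutes_ascent[of u n k] perm_length_ascent[of n u k] by simp
  consider "j = i" | "j = Suc i" | "Suc i < j"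
    using i(2) by linarith
  then show ?case
  proof cases
    case 1
    show ?thesis unfolding 1 by (rule w_i)
  next
    case 2
    have asc: "1 \<le> i" "Suc i < n" "w i < w (Suc i)" "w (Suc i) < w (Suc (Suc i))"
      using i(1) longer.prems 2 by (auto simp: ascent_def)
    let ?s = "simple_transposition i" and ?t = "simple_transposition (Suc i)"
    let ?d = "divided_difference i" and ?e = "divided_difference (Suc i)"
    have "ascent n (w \<circ> ?s) (Suc i)" "ascent n (w \<circ> ?s \<circ> ?t) i"
      "ascent n (w \<circ> ?t) i" "ascent n (w \<circ> ?t \<circ> ?s) (Suc i)"
      using asc by (auto simp: ascent_def transpose_def)
    then have "schubert n (w \<circ> ?s) = ?e (?d (schubert n (w \<circ> ?s \<circ> ?t \<circ> ?s)))"
      "schubert n (w \<circ> ?t) = ?d (?e (schubert n (w \<circ> ?t \<circ> ?s \<circ> ?t)))"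
      using one i(1) longer.prems 2 two IH by metis+
    moreover have "w \<circ> ?s \<circ> ?t \<circ> ?s = w \<circ> ?t \<circ> ?s \<circ> ?t"
      by (auto simp: fun_eq_iff transpose_def)
    ultimately show ?thesis
      unfolding 2 w_i by (simp only: divided_difference_braid)
  next
    case 3
    let ?s = "simple_transposition i" and ?t = "simple_transposition j"
    have "ascent n (w \<circ> ?s) j" "ascent n (w \<circ> ?t) i"
      using i(1) longer.prems 3 by (auto simp: ascent_def transpose_def)
    then have "schubert n (w \<circ> ?s) = divided_difference j (schubert n (w \<circ> ?s \<circ> ?t))"
      "schubert n (w \<circ> ?t) = divided_difference i (schubert n (w \<circ> ?t \<circ> ?s))"
      using one i(1) longer.prems IH by metis+
    moreover have "w \<circ> ?s \<circ> ?t = w \<circ> ?t \<circ> ?s"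
      using 3 by (auto simp: fun_eq_iff transpose_def)
    ultimately show ?thesis
      unfolding w_i by (simp only: divided_difference_comm[OF 3])
  qed
qed

text \<open>At an ascent of \<open>w\<close> the polynomial is itself a divided difference, hence symmetric, and is
  annihilated by a second one.\<close>

lemma schubert_family_schubert: "schubert_family n (schubert n)"
  unfolding schubert_family_def
proof (intro conjI allI impI)
  have no: "\<not> (longest_perm n permutes {1..n} \<and> (\<exists>i. ascent n (longest_perm n) i))"
    using not_ascent_longest_perm by blast
  show "schubert n (longest_perm n) =
      (\<Prod>(i, j) \<in> {(i, j). 1 \<le> i \<and> 1 \<le> j \<and> i + j \<le> n}. xvar i - yvar j)"
    unfolding staircase_product schubert.simps[of n "longest_perm n"] if_not_P[OF no] ..
next
  fix w i
  assume w: "w permutes {1..n} \<and> 1 \<le> i \<and> i < n"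
  let ?v = "w \<circ> simple_transposition i"
  show "divided_difference i (schubert n w) =
      (if perm_length n ?v < perm_length n w then schubert n ?v else 0)"
  proof (cases "ascent n w i")
    case True
    then have "divided_difference i (schubert n w) = 0"
      using w schubert_ascent[of w n i]
      by (simp add: divided_difference_eq_0_iff swap_x_divided_difference)
    then show ?thesis
      using True by (simp add: perm_length_ascent)
  next
    case False
    then have "ascent n ?v i"
      using not_ascent_iff w by (simp add: ascent_descent_swap)
    from schubert_ascent[OF _ this]
    have "schubert n ?v = divided_difference i (schubert n w)"
      using w permutes_comp_simple_transposition by (simp del: comp_apply)
    then show ?thesis
      using False w perm_length_decreases_iff by simp
  qed
qed

lemma schubert_family_double_schubert: "schubert_family n (double_schubert n)"
  unfolding double_schubert_def using schubert_family_schubert[of n] by (rule someI[of "schubert_family n"])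

lemma double_schubert_longest:
  "double_schubert n (longest_perm n) = diagram_product n (\<lambda>i. n - i)"
  using schubert_family_double_schubert[of n] unfolding schubert_family_def staircase_product
  by (rule conjunct1)

lemma double_schubert_ascent:
  assumes "w permutes {1..n}" "ascent n w i"
  shows "double_schubert n w =
    divided_difference i (double_schubert n (w \<circ> simple_transposition i))"
proof -
  let ?v = "w \<circ> simple_transposition i"
  have "?v permutes {1..n} \<and> 1 \<le> i \<and> i < n"
    using assms permutes_ascent by (auto simp: ascent_def)
  then have "divided_difference i (double_schubert n ?v) =
      (if perm_length n (?v \<circ> simple_transposition i) < perm_length n ?v
       then double_schubert n (?v \<circ> simple_transposition i) else 0)"
    using schubert_family_double_schubert[of n] unfolding schubert_family_def by blast
  then show ?thesis
    using perm_length_ascent[OF assms(2)] by simp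
qed

lemma double_schubert_symmetric:
  assumes "w permutes {1..n}" "ascent n w i"
  shows "swap_x i (double_schubert n w) = double_schubert n w"
  by (simp add: double_schubert_ascent[OF assms] swap_x_divided_difference)

section \<open>Double Schubert polynomials of dominant permutations\<close>

text \<open>Two rows of equal length are interchanged.\<close>

lemma swap_x_diagram_product:
  assumes "1 \<le> i" "i < n" "c i = c (Suc i)"
  shows "swap_x i (diagram_product n c) = diagram_product n c"
proof -
  let ?t = "simple_transposition i"
  have c: "c (?t a) = c a" for a
    using assms(3) by (simp add: transpose_def)
  have "swap_x i (diagram_product n c) = (\<Prod>a\<in>{1..n}. \<Prod>b\<in>{1..c (?t a)}. xvar (?t a) - yvar b)"
    by (simp add: diagram_product_def swap_x_hom c)
  also have "\<dots> = diagram_product n c"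
    unfolding diagram_product_def
    by (rule prod.reindex_bij_betw[of ?t]) (use assms in auto)
  finally show ?thesis .
qed

lemma diagram_product_add_box:
  assumes "i \<in> {1..n}"
  shows "diagram_product n (c(i := Suc (c i))) = (xvar i - yvar (Suc (c i))) * diagram_product n c"
proof -
  have "(\<Prod>a\<in>{1..n} - {i}. \<Prod>b\<in>{1..(c(i := Suc (c i))) a}. xvar a - yvar b) =
      (\<Prod>a\<in>{1..n} - {i}. \<Prod>b\<in>{1..c a}. xvar a - yvar b)"
    by (rule prod.cong) auto
  then show ?thesis
    using assms by (simp add: diagram_product_def prod.remove[of _ i] prod.nat_ivl_Suc' mult_ac)
qed

text \<open>The diagram grows to the full staircase one cell at a time. For a decreasing code an ascent is a
  pair of rows \<open>i, i + 1\<close> of equal length \<open>k\<close>. Choosing the first ascent makes row \<open>i - 1\<close> strictly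
  longer, so the code of \<open>w s\<^sub>i\<close>, which has one more cell in row \<open>i\<close>, is again decreasing. The new
  factor is \<open>x\<^sub>i - y\<^sub>k\<^sub>+\<^sub>1\<close>, the other factors together are symmetric in \<open>x\<^sub>i\<close> and \<open>x\<^sub>i\<^sub>+\<^sub>1\<close>, and the
  divided difference just removes the new factor.\<close>

lemma double_schubert_dominant:
  assumes "w permutes {1..n}" "\<forall>i. 1 \<le> i \<and> i < n \<longrightarrow> lehmer_code n w (Suc i) \<le> lehmer_code n w i"
  shows "double_schubert n w = diagram_product n (lehmer_code n w)"
  using assms
proof (induction w rule: ascent_induct)
  case (step w)
  show ?case
  proof (cases "\<exists>i. ascent n w i")
    case False
    then have "lehmer_code n w i = n - i" if "i \<in> {1..n}" for i
      using that step.hyps by (intro code_no_ascent[of _ _ 1]) auto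
    then have "diagram_product n (lehmer_code n w) = diagram_product n (\<lambda>i. n - i)"
      by (simp add: diagram_product_def)
    then show ?thesis
      using False step.hyps double_schubert_longest no_ascent_imp_longest by metis
  next
    case True
    define i where "i = (LEAST i. ascent n w i)"
    have i: "ascent n w i"
      unfolding i_def using True by (rule LeastI_ex)
    have i_least: "\<not> ascent n w k" if "k < i" for k
      using that not_less_Least unfolding i_def by blast
    let ?v = "w \<circ> simple_transposition i"
    have i_range: "1 \<le> i" "i < n"
      using i by (auto simp: ascent_def)
    have eq: "lehmer_code n w i = lehmer_code n w (Suc i)"
      using i i_range code_ascent_iff[OF step.hyps i_range] step.prems by (simp add: le_antisym)
    have code_v: "lehmer_code n ?v = (lehmer_code n w)(i := Suc (lehmer_code n w i))"
    proof
      show "lehmer_code n ?v k = ((lehmer_code n w)(i := Suc (lehmer_code n w i))) k" for k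
        using code_ascent[OF i] eq by (cases "k = i"; cases "k = Suc i") auto
    qed
    have "lehmer_code n ?v (Suc k) \<le> lehmer_code n ?v k" if "1 \<le> k" "k < n" for k
    proof (cases "Suc k = i")
      case True
      then have "\<not> lehmer_code n w k \<le> lehmer_code n w (Suc k)"
        using i_least[of k] code_ascent_iff[OF step.hyps that] by simp
      then show ?thesis
        using True by (simp add: code_v)
    next
      case False
      then show ?thesis
        using step.prems that by (auto simp: code_v intro: le_SucI)
    qed
    then have "double_schubert n ?v = diagram_product n (lehmer_code n ?v)"
      using step.IH[OF i] by blast
    also have "\<dots> = (xvar i - yvar (Suc (lehmer_code n w i))) * diagram_product n (lehmer_code n w)"
      unfolding code_v by (rule diagram_product_add_box) (use i_range in simp)
    finally have v: "double_schubert n ?v = \<dots>" .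
    have "divided_difference i (double_schubert n ?v) = diagram_product n (lehmer_code n w)"
      by (rule divided_difference_eqI)
        (simp add: v swap_x_hom swap_x_diagram_product[OF i_range eq] algebra_simps)
    then show ?thesis
      using double_schubert_ascent[OF step.hyps i] by simp
  qed
qed

section \<open>Monomials in the x-variables and degree bounds\<close>

definition x_expo :: "nat \<Rightarrow> (nat \<Rightarrow> nat) \<Rightarrow> (var \<Rightarrow>\<^sub>0 nat)" where
  "x_expo n c = (\<Sum>a\<in>{1..n}. Poly_Mapping.single (X a) (c a))"

lemma expo_x_expo [simp]:
  "expo (x_expo n c) (X k) = (if k \<in> {1..n} then c k else 0)"
  "expo (x_expo n c) (Y j) = 0"
  by (simp_all add: x_expo_def lookup_sum lookup_single when_def)

lemma prod_xvar_power: "(\<Prod>a\<in>{1..n}. xvar a ^ c a) = monom (x_expo n c) 1"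
  by (simp add: Var_power prod_monom x_expo_def)

lemma set_y_zero_diagram_product:
  "set_y_zero (diagram_product n c) = monom (x_expo n c) 1"
  unfolding prod_xvar_power[symmetric]
  by (simp add: diagram_product_def set_y_zero_hom)

definition degree_le :: "var \<Rightarrow> nat \<Rightarrow> poly_xy \<Rightarrow> bool" where
  "degree_le v d P \<longleftrightarrow> (\<forall>m. d < expo m v \<longrightarrow> coeff P m = 0)"

lemma degree_le_mult:
  assumes "degree_le v d P" "degree_le v e Q"
  shows "degree_le v (d + e) (P * Q)"
  unfolding degree_le_def
proof (intro allI impI)
  fix m assume m: "d + e < expo m v"
  show "coeff (P * Q) m = 0"
  proof (rule ccontr)
    assume "coeff (P * Q) m \<noteq> 0"
    then obtain p q where "m = p + q" "coeff P p \<noteq> 0" "coeff Q q \<noteq> 0"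
      using keys_mult[of P Q] by (auto simp: in_keys_iff)
    then have "expo p v \<le> d" "expo q v \<le> e" "expo m v = expo p v + expo q v"
      using assms by (auto simp: degree_le_def lookup_add not_less[symmetric])
    then show False
      using m by simp
  qed
qed

lemma degree_le_prod:
  assumes "finite A" "\<And>a. a \<in> A \<Longrightarrow> degree_le v (d a) (f a)"
  shows "degree_le v (\<Sum>a\<in>A. d a) (\<Prod>a\<in>A. f a)"
  using assms
proof (induction A rule: finite_induct)
  case empty
  show ?case
    by (auto simp: degree_le_def lookup_one when_def)
qed (simp add: degree_le_mult)

lemma degree_le_factor: "degree_le (X k) (if a = k then 1 else 0) (xvar a - yvar b)"
  by (auto simp: degree_le_def Var_def lookup_minus lookup_single when_def)

lemma degree_le_diagram_product:
  assumes "k \<in> {1..n}"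
  shows "degree_le (X k) (c k) (diagram_product n c)"
proof -
  have "degree_le (X k) (\<Sum>a\<in>{1..n}. \<Sum>b\<in>{1..c a}. if a = k then 1 else 0) (diagram_product n c)"
    unfolding diagram_product_def by (intro degree_le_prod degree_le_factor) auto
  moreover have "(\<Sum>a\<in>{1..n}. \<Sum>b\<in>{1..c a}. if a = k then 1 else 0) = c k"
    using assms by (simp add: if_distrib cong: if_cong)
  ultimately show ?thesis
    by simp
qed

section \<open>The monomial given by the Lehmer code\<close>

text \<open>Comparison of coefficients in \<open>(x\<^sub>i - x\<^sub>i\<^sub>+\<^sub>1) Q = P - s\<^sub>i P\<close> at the monomial \<open>x\<^sub>i\<^sub>+\<^sub>1\<close> times \<open>m\<close>. The
  coefficient of \<open>x\<^sub>i Q\<close> on the right is 0 or one of \<open>Q\<close> at a monomial with smaller exponent of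
  \<open>x\<^sub>i\<close>, so this is a recursion for the coefficients of \<open>Q\<close>.\<close>

lemma coeff_quotient:
  assumes "(xvar i - xvar (Suc i)) * Q = P - swap_x i P"
  shows "coeff Q m = coeff (xvar i * Q) (Poly_Mapping.single (X (Suc i)) 1 + m)
    - coeff P (Poly_Mapping.single (X (Suc i)) 1 + m)
    + coeff P (swap_expo i (Poly_Mapping.single (X (Suc i)) 1 + m))"
  using arg_cong[OF assms, of "\<lambda>R. coeff R (Poly_Mapping.single (X (Suc i)) 1 + m)"]
  by (simp add: left_diff_distrib lookup_minus coeff_Var_mult_add[simplified] coeff_swap_x)

lemma coeff_Var_mult_cases:
  obtains "coeff (Var v * Q) m = 0"
  | m' where "m = Poly_Mapping.single v 1 + m'" "coeff (Var v * Q) m = coeff Q m'"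
proof (cases "expo m v = 0")
  case True
  then show thesis
    using that(1) coeff_Var_mult_0 by blast
next
  case False
  have "m = Poly_Mapping.single v 1 + (m - Poly_Mapping.single v 1)"
    by (rule poly_mapping_eqI) (use False in \<open>auto simp: lookup_add lookup_minus lookup_single when_def\<close>)
  then show thesis
    using that(2) coeff_Var_mult_add by metis
qed

text \<open>The recursion moves an exponent from \<open>x\<^sub>i\<close> to \<open>x\<^sub>i\<^sub>+\<^sub>1\<close> in each step. If the coefficients of \<open>P\<close> that
  it meets vanish on the way, the coefficient of \<open>Q\<close> vanishes, as the exponent of \<open>x\<^sub>i\<close> runs out.\<close>

lemma coeff_quotient_eq_0:
  assumes quot: "(xvar i - xvar (Suc i)) * Q = P - swap_x i P"
    and closed: "\<And>m m'. B m \<Longrightarrow>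
      Poly_Mapping.single (X (Suc i)) 1 + m = Poly_Mapping.single (X i) 1 + m' \<Longrightarrow> B m'"
    and zero: "\<And>m. B m \<Longrightarrow> coeff P (Poly_Mapping.single (X (Suc i)) 1 + m) = 0"
      "\<And>m. B m \<Longrightarrow> coeff P (swap_expo i (Poly_Mapping.single (X (Suc i)) 1 + m)) = 0"
    and "B m"
  shows "coeff Q m = 0"
  using \<open>B m\<close>
proof (induction "expo m (X i)" arbitrary: m rule: less_induct)
  case less
  let ?M = "Poly_Mapping.single (X (Suc i)) 1 + m"
  have "coeff (xvar i * Q) ?M = 0"
  proof (rule coeff_Var_mult_cases[of "X i" Q ?M])
    fix m' assume m': "?M = Poly_Mapping.single (X i) 1 + m'" "coeff (xvar i * Q) ?M = coeff Q m'"
    from arg_cong[OF m'(1), of "\<lambda>m. expo m (X i)"] have "expo m' (X i) < expo m (X i)"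
      by (simp add: lookup_add lookup_single when_def)
    then show ?thesis
      using less closed m' by metis
  qed
  then show ?case
    using coeff_quotient[OF quot, of m] zero[OF less.prems] by simp
qed

text \<open>The condition that divided differences preserve: the \<open>x\<close>-part of every monomial that occurs divides
  \<open>x\<^sub>1\<^sup>n\<^sup>-\<^sup>1 x\<^sub>2\<^sup>n\<^sup>-\<^sup>2 \<dots>\<close>, the code monomial of the longest permutation.\<close>

definition staircase_bounded :: "nat \<Rightarrow> poly_xy \<Rightarrow> bool" where
  "staircase_bounded n P \<longleftrightarrow> (\<forall>k\<in>{1..n}. degree_le (X k) (n - k) P)"

lemma staircase_boundedD:
  "staircase_bounded n P \<Longrightarrow> 1 \<le> k \<Longrightarrow> k \<le> n \<Longrightarrow> n - k < expo m (X k) \<Longrightarrow> coeff P m = 0"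
  by (auto simp: staircase_bounded_def degree_le_def)

text \<open>For \<open>x\<^sub>i\<^sub>+\<^sub>1\<close> the bound \<open>n - i - 1\<close> has to be proved from \<open>P\<close> alone: the recursion starts at a
  monomial with exponent at least \<open>n - i + 1\<close> of \<open>x\<^sub>i\<^sub>+\<^sub>1\<close> in \<open>P\<close>, which is beyond the bounds for both
  \<open>x\<^sub>i\<close> and \<open>x\<^sub>i\<^sub>+\<^sub>1\<close>, and only increases it. The bound for \<open>x\<^sub>i\<close> follows by symmetry of \<open>Q\<close>.\<close>

lemma staircase_bounded_quotient:
  assumes "staircase_bounded n P" "1 \<le> i" "i < n"
    and quot: "(xvar i - xvar (Suc i)) * Q = P - swap_x i P" and sym: "swap_x i Q = Q"
  shows "staircase_bounded n Q"
proof -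
  have expos: "expo m' (X k) = (if k = Suc i then Suc (expo m (X k)) else
      if k = i then expo m (X k) - 1 else expo m (X k))"
    if "Poly_Mapping.single (X (Suc i)) 1 + m = Poly_Mapping.single (X i) 1 + m'" for m m' k
    using arg_cong[OF that, of "\<lambda>m. expo m (X k)"]
    by (auto simp: lookup_add lookup_single when_def split: if_splits)
  have next_zero: "coeff Q m = 0" if "n - i \<le> expo m (X (Suc i))" for m
  proof (rule coeff_quotient_eq_0[OF quot, where B = "\<lambda>m. n - i \<le> expo m (X (Suc i))"])
    show "n - i \<le> expo m' (X (Suc i))"
      if "n - i \<le> expo m (X (Suc i))"
        "Poly_Mapping.single (X (Suc i)) 1 + m = Poly_Mapping.single (X i) 1 + m'" for m m'
      using expos[OF that(2), of "Suc i"] that(1) by simp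
    show "coeff P (Poly_Mapping.single (X (Suc i)) 1 + m) = 0" if "n - i \<le> expo m (X (Suc i))" for m
      by (rule staircase_boundedD[OF assms(1), of "Suc i"])
        (use that assms(3) in \<open>auto simp: lookup_add\<close>)
    show "coeff P (swap_expo i (Poly_Mapping.single (X (Suc i)) 1 + m)) = 0"
      if "n - i \<le> expo m (X (Suc i))" for m
      by (rule staircase_boundedD[OF assms(1), of i])
        (use that assms(2,3) in \<open>auto simp: lookup_add\<close>)
  qed (rule that)
  have "coeff Q m = 0" if k: "k \<in> {1..n}" "n - k < expo m (X k)" for k m
  proof -
    consider "k = Suc i" | "k = i" | "k \<noteq> i" "k \<noteq> Suc i" by blast
    then show ?thesis
    proof cases
      case 1
      then show ?thesis
        using next_zero[of m] k by simp
    next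
      case 2
      then have "coeff Q (swap_expo i m) = 0"
        using next_zero[of "swap_expo i m"] k by simp
      then show ?thesis
        using coeff_swap_x[of i Q m] sym by simp
    next
      case 3
      show ?thesis
      proof (rule coeff_quotient_eq_0[OF quot, where B = "\<lambda>m. n - k < expo m (X k)"])
        show "n - k < expo m' (X k)"
          if "n - k < expo m (X k)"
            "Poly_Mapping.single (X (Suc i)) 1 + m = Poly_Mapping.single (X i) 1 + m'" for m m'
          using expos[OF that(2), of k] that(1) 3 by simp
        show "coeff P (Poly_Mapping.single (X (Suc i)) 1 + m) = 0" if "n - k < expo m (X k)" for m
          by (rule staircase_boundedD[OF assms(1), of k])
            (use that k(1) in \<open>auto simp: lookup_add\<close>)
        show "coeff P (swap_expo i (Poly_Mapping.single (X (Suc i)) 1 + m)) = 0"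
          if "n - k < expo m (X k)" for m
          by (rule staircase_boundedD[OF assms(1), of k])
            (use that k(1) 3 in \<open>auto simp: lookup_add\<close>)
      qed (rule k(2))
    qed
  qed
  then show ?thesis
    by (auto simp: staircase_bounded_def degree_le_def)
qed

text \<open>If the exponent of \<open>x\<^sub>i\<^sub>+\<^sub>1\<close> is as large as the staircase admits, the recursion stops at once and a
  single coefficient of \<open>P\<close> remains.\<close>

lemma coeff_quotient_extremal:
  assumes "staircase_bounded n P" "staircase_bounded n Q" "1 \<le> i" "i < n"
    and quot: "(xvar i - xvar (Suc i)) * Q = P - swap_x i P"
    and m: "expo m (X (Suc i)) = n - Suc i"
  shows "coeff Q m = coeff P (swap_expo i (Poly_Mapping.single (X (Suc i)) 1 + m))"
proof -
  let ?M = "Poly_Mapping.single (X (Suc i)) 1 + m"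
  have "coeff P ?M = 0"
    by (rule staircase_boundedD[OF assms(1), of "Suc i"]) (use assms(4) m in \<open>auto simp: lookup_add\<close>)
  moreover have "coeff (xvar i * Q) ?M = 0"
  proof (rule coeff_Var_mult_cases[of "X i" Q ?M])
    fix m' assume m': "?M = Poly_Mapping.single (X i) 1 + m'" "coeff (xvar i * Q) ?M = coeff Q m'"
    from arg_cong[OF m'(1), of "\<lambda>m. expo m (X (Suc i))"] have "n - Suc i < expo m' (X (Suc i))"
      using m by (simp add: lookup_add lookup_single when_def)
    then show ?thesis
      using m'(2) staircase_boundedD[OF assms(2), of "Suc i"] assms(4) by simp
  qed
  ultimately show ?thesis
    using coeff_quotient[OF quot, of m] by simp
qed

text \<open>The last ascent \<open>i\<close> is the choice that makes the exponent \<open>n - i - 1\<close> of \<open>x\<^sub>i\<^sub>+\<^sub>1\<close> in the code monomial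
  of \<open>w\<close> extremal, because the values after it decrease. The coefficient of \<open>P\<close> that remains is then
  the one at the code monomial of \<open>w s\<^sub>i\<close>, so the value 1 descends from the longest permutation.\<close>

lemma double_schubert_code_coeff:
  assumes "w permutes {1..n}"
  shows "staircase_bounded n (double_schubert n w) \<and>
    coeff (double_schubert n w) (x_expo n (lehmer_code n w)) = 1"
  using assms
proof (induction w rule: ascent_induct)
  case (step w)
  show ?case
  proof (cases "\<exists>i. ascent n w i")
    case False
    then have eq: "double_schubert n w = diagram_product n (\<lambda>i. n - i)"
      using step.hyps double_schubert_longest no_ascent_imp_longest by metis
    have "lehmer_code n w i = n - i" if "i \<in> {1..n}" for i
      using False that step.hyps by (intro code_no_ascent[of _ _ 1]) auto
    then have "x_expo n (lehmer_code n w) = x_expo n (\<lambda>i. n - i)"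
      by (simp add: x_expo_def)
    moreover have "coeff (diagram_product n (\<lambda>i. n - i)) (x_expo n (\<lambda>i. n - i)) = 1"
      using coeff_set_y_zero[of "x_expo n (\<lambda>i. n - i)" "diagram_product n (\<lambda>i. n - i)"]
      by (simp add: set_y_zero_diagram_product)
    ultimately show ?thesis
      using degree_le_diagram_product[of _ n "\<lambda>i. n - i"] by (simp add: eq staircase_bounded_def)
  next
    case True
    define i where "i = Max {i. ascent n w i}"
    have fin: "finite {i. ascent n w i}"
      by (rule finite_subset[of _ "{..n}"]) (auto simp: ascent_def)
    have i: "ascent n w i"
      using Max_in[OF fin] True by (auto simp: i_def)
    have i_range: "1 \<le> i" "i < n"
      using i by (auto simp: ascent_def)
    have "\<not> ascent n w k" if "Suc i \<le> k" for k
      using Max_ge[OF fin, of k] that by (auto simp: i_def)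
    then have code_next: "lehmer_code n w (Suc i) = n - Suc i"
      using i_range step.hyps by (intro code_no_ascent[of _ _ "Suc i"]) auto
    let ?v = "w \<circ> simple_transposition i"
    have quot: "(xvar i - xvar (Suc i)) * double_schubert n w =
        double_schubert n ?v - swap_x i (double_schubert n ?v)"
      by (simp add: double_schubert_ascent[OF step.hyps i] divided_difference_mult del: comp_apply)
    have bounded: "staircase_bounded n (double_schubert n w)"
      by (rule staircase_bounded_quotient[OF conjunct1[OF step.IH[OF i]] i_range quot
          double_schubert_symmetric[OF step.hyps i]])
    let ?m = "x_expo n (lehmer_code n w)"
    have "swap_expo i (Poly_Mapping.single (X (Suc i)) 1 + ?m) = x_expo n (lehmer_code n ?v)"
    proof (rule poly_mapping_eqI)
      fix u
      show "expo (swap_expo i (Poly_Mapping.single (X (Suc i)) 1 + ?m)) u =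
          expo (x_expo n (lehmer_code n ?v)) u"
      proof (cases u)
        case (X k)
        consider "k = i" | "k = Suc i" | "k \<noteq> i" "k \<noteq> Suc i" by blast
        then show ?thesis
          by cases (use X i_range code_ascent[OF i] in \<open>auto simp: lookup_add lookup_single when_def\<close>)
      qed (simp add: lookup_add lookup_single)
    qed
    moreover have "coeff (double_schubert n w) ?m =
        coeff (double_schubert n ?v) (swap_expo i (Poly_Mapping.single (X (Suc i)) 1 + ?m))"
      by (rule coeff_quotient_extremal[OF conjunct1[OF step.IH[OF i]] bounded i_range quot])
        (use i_range code_next in simp)
    ultimately show ?thesis
      using bounded step.IH[OF i] by simp
  qed
qed

text \<open>At an ascent the polynomial is symmetric in \<open>x\<^sub>i\<close> and \<open>x\<^sub>i\<^sub>+\<^sub>1\<close>, so the coefficient 1 at the code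
  monomial also occurs at its mirror image. A single monomial leaves room for only one of them.\<close>

lemma monomial_imp_code_decreasing:
  assumes w: "w permutes {1..n}" and mono: "is_monomial n (single_schubert n w)"
    and i: "1 \<le> i" "i < n"
  shows "lehmer_code n w (Suc i) \<le> lehmer_code n w i"
proof (cases "ascent n w i")
  case True
  let ?m = "x_expo n (lehmer_code n w)"
  obtain a where a: "single_schubert n w = monom (x_expo n a) 1"
    using mono unfolding is_monomial_def prod_xvar_power by blast
  have unique: "m = x_expo n a"
    if "coeff (double_schubert n w) m = 1" "\<And>j. expo m (Y j) = 0" for m
    using coeff_set_y_zero[OF that(2), of "double_schubert n w"] that(1) a
    by (auto simp: single_schubert_def lookup_single when_def split: if_splits)
  have one: "coeff (double_schubert n w) ?m = 1"
    using double_schubert_code_coeff[OF w] by simp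
  have "coeff (double_schubert n w) (swap_expo i ?m) = 1"
    using one coeff_swap_x[of i "double_schubert n w" ?m] double_schubert_symmetric[OF w True] by simp
  then have "swap_expo i ?m = x_expo n a"
    by (rule unique) simp
  moreover have "?m = x_expo n a"
    using one by (rule unique) simp
  ultimately have "expo (swap_expo i ?m) (X i) = expo ?m (X i)"
    by simp
  then show ?thesis
    using i by simp
next
  case False
  then show ?thesis
    using code_ascent_iff[OF w i] by simp
qed

section \<open>The characterization\<close>

text \<open>A binomial product specializes to a monomial. Hence only the step from monomials to dominant
  permutations needs the analysis of coefficients.\<close>

lemma set_y_zero_binomial_product:
  assumes "is_binomial_product n P"
  shows "is_monomial n (set_y_zero P)"
proof -
  have "is_monomial n (set_y_zero (\<Prod>(i, j) \<in># M. xvar i - yvar j))"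
    if "set_mset M \<subseteq> {1..n} \<times> {1..n}" for M :: "(nat \<times> nat) multiset"
    using that
  proof (induction M)
    case empty
    show ?case
      unfolding is_monomial_def by (rule exI[of _ "\<lambda>_. 0"]) simp
  next
    case (add p M)
    obtain i j where p: "p = (i, j)" "i \<in> {1..n}"
      using add.prems by auto
    obtain a where a: "set_y_zero (\<Prod>(i, j) \<in># M. xvar i - yvar j) = (\<Prod>i\<in>{1..n}. xvar i ^ a i)"
      using add by (auto simp: is_monomial_def)
    have "(\<Prod>k\<in>{1..n}. xvar k ^ (a(i := Suc (a i))) k) = xvar i * (\<Prod>k\<in>{1..n}. xvar k ^ a k)"
    proof -
      have "(\<Prod>k\<in>{1..n} - {i}. xvar k ^ (a(i := Suc (a i))) k) = (\<Prod>k\<in>{1..n} - {i}. xvar k ^ a k)"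
        by (rule prod.cong) auto
      then show ?thesis
        using p(2) by (simp add: prod.remove[of _ i] mult_ac)
    qed
    then have "set_y_zero (\<Prod>(i, j) \<in># add_mset p M. xvar i - yvar j) =
        (\<Prod>k\<in>{1..n}. xvar k ^ (a(i := Suc (a i))) k)"
      using a p(1) by (simp add: set_y_zero_hom del: fun_upd_apply)
    then show ?case
      unfolding is_monomial_def by (rule exI[of _ "a(i := Suc (a i))"])
  qed
  then show ?thesis
    using assms by (auto simp: is_binomial_product_def)
qed

lemma is_binomial_product_diagram_product:
  assumes "\<And>a. a \<in> {1..n} \<Longrightarrow> c a \<le> n"
  shows "is_binomial_product n (diagram_product n c)"
proof -
  let ?D = "SIGMA a:{1..n}. {1..c a}"
  have "diagram_product n c = (\<Prod>(a, b) \<in> ?D. xvar a - yvar b)"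
    by (simp add: diagram_product_def prod.Sigma)
  also have "\<dots> = (\<Prod>(a, b) \<in># mset_set ?D. xvar a - yvar b)"
    by (rule prod_unfold_prod_mset)
  finally have "diagram_product n c = \<dots>" .
  moreover have "set_mset (mset_set ?D) \<subseteq> {1..n} \<times> {1..n}"
    using assms by fastforce
  ultimately show ?thesis
    unfolding is_binomial_product_def by blast
qed

theorem proposition4p3:
  fixes n :: nat and w :: "nat \<Rightarrow> nat"
  assumes "w permutes {1..n}"
  shows "(dominant n w \<longleftrightarrow> is_monomial n (single_schubert n w)) \<and>
         (dominant n w \<longleftrightarrow> is_binomial_product n (double_schubert n w))"
proof -
  have "is_binomial_product n (double_schubert n w)" if "dominant n w"
  proof -
    have "double_schubert n w = diagram_product n (lehmer_code n w)"
      using that assms by (intro double_schubert_dominant) (simp_all add: dominant_iff_code_decreasing)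
    then show ?thesis
      using is_binomial_product_diagram_product[of n "lehmer_code n w"] code_le
      by (metis diff_le_self le_trans)
  qed
  moreover have "is_monomial n (single_schubert n w)" if "is_binomial_product n (double_schubert n w)"
    unfolding single_schubert_def using that by (rule set_y_zero_binomial_product)
  moreover have "dominant n w" if "is_monomial n (single_schubert n w)"
    using monomial_imp_code_decreasing[OF assms that] dominant_iff_code_decreasing[OF assms] by simp
  ultimately show ?thesis
    by blast
qed

end
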